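(* Let $0<l_1,l_2,l_3<\infty$ and let $\Omega\subset\mathbb{R}^3$ be a bounded domain contained in $(0,l_1)\times(0,l_2)\times(0,l_3)$. Let $\alpha=(\alpha_{ij})_{i,j=1}^3\in L^\infty(\Omega)$ be a self-adjoint matrix valued function and define the diagonal matrix $\tilde\alpha=\mathrm{diag}(\tilde\alpha_1,\tilde\alpha_2,\tilde\alpha_3)$ by \[ \tilde\alpha_1=\alpha_{11}-(|\mathrm{Re}\,\alpha_{12}|+|\mathrm{Im}\,\alpha_{12}|+|\mathrm{Re}\,\alpha_{13}|+|\mathrm{Im}\,\alpha_{13}|), \] \[ \tilde\alpha_2=\alpha_{22}-(|\mathrm{Re}\,\alpha_{12}|+|\mathrm{Im}\,\alpha_{12}|+|\mathrm{Re}\,\alpha_{23}|+|\mathrm{Im}\,\alpha_{23}|), \] \[ \tilde\alpha_3=\alpha_{33}-(|\mathrm{Re}\,\alpha_{13}|+|\mathrm{Im}\,\alpha_{13}|+|\mathrm{Re}\,\alpha_{23}|+|\mathrm{Im}\,\alpha_{23}|). \] Suppose $\tilde\alpha$ is uniformly positive definite, i.e. there are constants $\underline{\tilde\alpha}_i>0$ with $\underline{\tilde\alpha}_i\|\varphi\|^2_{L^2(\Omega)}\le(\tilde\alpha_i\varphi,\varphi)_{L^2(\Omega)}$ for all $\varphi\in L^2(\Omega)$, $i=1,2,3$. Let $c_{\mathrm{f},\alpha}$ be the smallest constant such that $\|\varphi\|_{L^2(\Omega)}\le c_{\mathrm{f},\alpha}\sqrt{(\alpha\nabla\varphi,\nabla\varphi)_{L^2(\Omega)}}$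 for all $\varphi\in\mathring{H}^1(\Omega)$. Then \[ c_{\mathrm{f},\alpha}\le\Big(\pi\sqrt{\tfrac{\underline{\tilde\alpha}_1}{l_1^2}+\tfrac{\underline{\tilde\alpha}_2}{l_2^2}+\tfrac{\underline{\tilde\alpha}_3}{l_3^2}}\Big)^{-1}. \]
   Context: $\mathring{H}^1(\Omega)$ is the closure of $C_c^\infty(\Omega)$ in $H^1(\Omega)=\{\varphi\in L^2(\Omega):\nabla\varphi\in L^2(\Omega)\}$. Functions may be complex valued; self-adjoint means equal to its conjugate transpose. *)

theory Defs
  imports "HOL-Analysis.Analysis"
begin

fun dpart :: "3 list \<Rightarrow> (real^3 \<Rightarrow> complex) \<Rightarrow> real^3 \<Rightarrow> complex" where
  "dpart [] f = f"
| "dpart (k # ks) f = (\<lambda>x. frechet_derivative (dpart ks f) (at x) (axis k 1))"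

definition smooth_fun :: "(real^3 \<Rightarrow> complex) \<Rightarrow> bool" where
  "smooth_fun f \<longleftrightarrow> (\<forall>ks. dpart ks f differentiable_on UNIV)"

definition tsupport :: "(real^3 \<Rightarrow> complex) \<Rightarrow> (real^3) set" where
  "tsupport f = closure {x. f x \<noteq> 0}"

definition test_fun :: "(real^3) set \<Rightarrow> (real^3 \<Rightarrow> complex) \<Rightarrow> bool" where
  "test_fun \<Omega> f \<longleftrightarrow> smooth_fun f \<and> compact (tsupport f) \<and> tsupport f \<subseteq> \<Omega>"

definition grad :: "(real^3 \<Rightarrow> complex) \<Rightarrow> real^3 \<Rightarrow> complex^3" where
  "grad f x = (\<chi> k. frechet_derivative f (at x) (axis k 1))"

definition L2 :: "(real^3) set \<Rightarrow> (real^3 \<Rightarrow> complex) \<Rightarrow> bool" where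
  "L2 \<Omega> f \<longleftrightarrow> f \<in> borel_measurable (lebesgue_on \<Omega>)
      \<and> integrable (lebesgue_on \<Omega>) (\<lambda>x. (cmod (f x))^2)"

definition L2norm :: "(real^3) set \<Rightarrow> (real^3 \<Rightarrow> complex) \<Rightarrow> real" where
  "L2norm \<Omega> f = sqrt (\<integral>x. (cmod (f x))^2 \<partial>lebesgue_on \<Omega>)"

definition L2inner :: "(real^3) set \<Rightarrow> (real^3 \<Rightarrow> complex) \<Rightarrow> (real^3 \<Rightarrow> complex) \<Rightarrow> complex" where
  "L2inner \<Omega> f g = (\<integral>x. f x * cnj (g x) \<partial>lebesgue_on \<Omega>)"

text \<open>H01 Omega phi g: phi belongs to the closure of C_c^infinity(Omega) in H^1(Omega),
  and g is its gradient (the L^2 limit of the gradients of the approximating test functions).\<close>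
definition H01 :: "(real^3) set \<Rightarrow> (real^3 \<Rightarrow> complex) \<Rightarrow> (real^3 \<Rightarrow> complex^3) \<Rightarrow> bool" where
  "H01 \<Omega> \<phi> g \<longleftrightarrow> L2 \<Omega> \<phi> \<and> (\<forall>k. L2 \<Omega> (\<lambda>x. g x $ k)) \<and>
     (\<exists>\<psi> :: nat \<Rightarrow> real^3 \<Rightarrow> complex. (\<forall>n. test_fun \<Omega> (\<psi> n)) \<and>
        (\<lambda>n. L2norm \<Omega> (\<lambda>x. \<psi> n x - \<phi> x)) \<longlonglongrightarrow> 0 \<and>
        (\<forall>k. (\<lambda>n. L2norm \<Omega> (\<lambda>x. grad (\<psi> n) x $ k - g x $ k)) \<longlonglongrightarrow> 0))"

definition energy :: "(real^3) set \<Rightarrow> (real^3 \<Rightarrow> complex^3^3) \<Rightarrow> (real^3 \<Rightarrow> complex^3) \<Rightarrow> complex" where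
  "energy \<Omega> \<alpha> g = (\<integral>x. (\<Sum>i\<in>UNIV. \<Sum>j\<in>UNIV. \<alpha> x $ i $ j * g x $ j * cnj (g x $ i)) \<partial>lebesgue_on \<Omega>)"

definition atilde1 :: "(real^3 \<Rightarrow> complex^3^3) \<Rightarrow> real^3 \<Rightarrow> real" where
  "atilde1 \<alpha> x = Re (\<alpha> x $ 1 $ 1) - (\<bar>Re (\<alpha> x $ 1 $ 2)\<bar> + \<bar>Im (\<alpha> x $ 1 $ 2)\<bar>
      + \<bar>Re (\<alpha> x $ 1 $ 3)\<bar> + \<bar>Im (\<alpha> x $ 1 $ 3)\<bar>)"

definition atilde2 :: "(real^3 \<Rightarrow> complex^3^3) \<Rightarrow> real^3 \<Rightarrow> real" where
  "atilde2 \<alpha> x = Re (\<alpha> x $ 2 $ 2) - (\<bar>Re (\<alpha> x $ 1 $ 2)\<bar> + \<bar>Im (\<alpha> x $ 1 $ 2)\<bar>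
      + \<bar>Re (\<alpha> x $ 2 $ 3)\<bar> + \<bar>Im (\<alpha> x $ 2 $ 3)\<bar>)"

definition atilde3 :: "(real^3 \<Rightarrow> complex^3^3) \<Rightarrow> real^3 \<Rightarrow> real" where
  "atilde3 \<alpha> x = Re (\<alpha> x $ 3 $ 3) - (\<bar>Re (\<alpha> x $ 1 $ 3)\<bar> + \<bar>Im (\<alpha> x $ 1 $ 3)\<bar>
      + \<bar>Re (\<alpha> x $ 2 $ 3)\<bar> + \<bar>Im (\<alpha> x $ 2 $ 3)\<bar>)"

definition cf :: "(real^3) set \<Rightarrow> (real^3 \<Rightarrow> complex^3^3) \<Rightarrow> real" where
  "cf \<Omega> \<alpha> = Inf {c. 0 \<le> c \<and> (\<forall>\<phi> g. H01 \<Omega> \<phi> g \<longrightarrow>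
       L2norm \<Omega> \<phi> \<le> c * sqrt (Re (energy \<Omega> \<alpha> g)))}"

end

theory Submission
  imports Defs
begin

text \<open>
  Hermitian symmetry and the inequality of arithmetic and geometric means bound the energy density
  pointwise from below by the sum of the terms \<open>\<alpha>\<^sub>i |g\<^sub>i|\<^sup>2\<close> with the reduced coefficients, so it
  suffices to show \<open>(\<pi>/l)\<^sup>2 \<parallel>\<psi>\<parallel>\<^sup>2 \<le> \<parallel>\<partial>\<^sub>k \<psi>\<parallel>\<^sup>2\<close> in each coordinate direction, first for test functions
  and then by passing to the limit. With \<open>c(t) = (\<pi>/l) cot (\<pi>t/l)\<close>, which satisfies
  \<open>c' = -((\<pi>/l)\<^sup>2 + c\<^sup>2)\<close>, one has the identity
  \<open>|\<partial>\<^sub>k \<psi>|\<^sup>2 - (\<pi>/l)\<^sup>2 |\<psi>|\<^sup>2 = |\<partial>\<^sub>k \<psi> - c \<psi>|\<^sup>2 + \<partial>\<^sub>k (c |\<psi>|\<^sup>2)\<close>. The last term integrates to zero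
  because Lebesgue measure is translation invariant.
\<close>

section \<open>Directional derivatives of compactly supported functions integrate to zero\<close>

text \<open>Every difference quotient of \<open>F\<close> in direction \<open>e\<close> integrates
  to zero, since translating \<open>F\<close> does not change its integral. Dominated convergence
  carries this over to the limit \<open>G\<close>. The argument uses only a bound on
  \<open>G\<close>; measurability of \<open>G\<close> follows because it is a pointwise limit of
  measurable quotients.\<close>

lemma integral_directional_derivative_eq_0:
  fixes F G :: "'a::euclidean_space \<Rightarrow> real"
  assumes F: "continuous_on UNIV F" and S: "compact S" "\<And>x. x \<notin> S \<Longrightarrow> F x = 0"
    and D: "\<And>x. ((\<lambda>t. F (x + t *\<^sub>R e)) has_real_derivative G x) (at 0)"
    and B: "\<And>x. \<bar>G x\<bar> \<le> B"
  shows "integrable lborel G" and "integral\<^sup>L lborel G = 0"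
proof -
  have Fm[measurable]: "F \<in> borel_measurable borel"
    using F by (rule borel_measurable_continuous_onI)
  have B0: "B \<ge> 0" using B[of undefined] by linarith
  have iF: "integrable lborel F"
  proof -
    have "integrable lborel (\<lambda>x. indicator S x *\<^sub>R F x)"
      by (rule borel_integrable_compact[OF S(1) continuous_on_subset[OF F]]) auto
    also have "(\<lambda>x. indicator S x *\<^sub>R F x) = F"
      using S(2) by (auto simp: indicator_def fun_eq_iff)
    finally show ?thesis .
  qed
  have shift: "integrable lborel (\<lambda>x. F (x + v))" "(\<integral>x. F (x + v) \<partial>lborel) = integral\<^sup>L lborel F" for v
  proof -
    have d: "distr lborel borel (\<lambda>x. x + v) = lborel"
      using lborel_distr_plus[of v] by (simp add: add.commute[of _ v])
    show "integrable lborel (\<lambda>x. F (x + v))"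
      using iF by (subst (asm) d[symmetric], subst (asm) integrable_distr_eq) auto
    show "(\<integral>x. F (x + v) \<partial>lborel) = integral\<^sup>L lborel F"
      by (subst (2) d[symmetric], subst integral_distr) auto
  qed
  obtain R where R: "\<And>x. x \<in> S \<Longrightarrow> norm x \<le> R"
    using compact_imp_bounded[OF S(1)] unfolding bounded_iff by blast
  \<comment> \<open>Assumption \<open>D\<close> speaks of parameter 0 only; moving the base point to
    \<open>x + s *\<^sub>R e\<close> gives the derivative at every \<open>s\<close>, so the mean
    value theorem applies along the line.\<close>
  have lip: "\<bar>F (x + t *\<^sub>R e) - F x\<bar> \<le> B * t" if "t > 0" for x t
  proof -
    have "((\<lambda>t. F (x + t *\<^sub>R e)) has_real_derivative G (x + s *\<^sub>R e)) (at s)" for s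
    proof -
      have "((\<lambda>t. F (x + (t + s) *\<^sub>R e)) has_real_derivative G (x + s *\<^sub>R e)) (at 0)"
        using D[of "x + s *\<^sub>R e"] by (simp add: scaleR_add_left algebra_simps)
      then show ?thesis using DERIV_shift[of "\<lambda>t. F (x + t *\<^sub>R e)" "G (x + s *\<^sub>R e)" 0 s] by simp
    qed
    from MVT2[OF that this] obtain z where "F (x + t *\<^sub>R e) - F (x + 0 *\<^sub>R e) = (t - 0) * G (x + z *\<^sub>R e)"
      by blast
    then show ?thesis using that B[of "x + z *\<^sub>R e"]
      by (simp add: abs_mult mult.commute mult_right_mono)
  qed
  define h where "h n = inverse (real (Suc n))" for n
  have h: "h n > 0" "h n \<le> 1" "h \<longlonglongrightarrow> 0" for n
    unfolding h_def using LIMSEQ_inverse_real_of_nat by (auto simp: field_simps)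
  define s where "s n x = (F (x + h n *\<^sub>R e) - F x) / h n" for n x
  have sG: "(\<lambda>n. s n x) \<longlonglongrightarrow> G x" for x
  proof -
    have "((\<lambda>t. (F (x + t *\<^sub>R e) - F x) / t) \<longlongrightarrow> G x) (at 0)"
      using D[of x] by (simp add: DERIV_def)
    moreover have "filterlim h (at 0) sequentially"
      using h by (auto simp: filterlim_at less_imp_neq[THEN not_sym])
    ultimately show ?thesis unfolding s_def by (rule filterlim_compose)
  qed
  have sm[measurable]: "s n \<in> borel_measurable borel" for n
    unfolding s_def by measurable
  have Gm: "G \<in> borel_measurable lborel"
    by (rule borel_measurable_LIMSEQ_real[OF sG]) auto
  \<comment> \<open>Inside the ball this is \<open>lip\<close>. Outside it,
    \<open>h n \<le> 1\<close> keeps \<open>x + h n *\<^sub>R e\<close> at norm greater than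
    \<open>R\<close>, so neither point lies in \<open>S\<close> and the quotient is 0. The radius
    \<open>R + norm e\<close> thus serves all \<open>n\<close> at once.\<close>
  have bound: "norm (s n x) \<le> indicator (cball 0 (R + norm e)) x * B" for n x
  proof (cases "x \<in> cball 0 (R + norm e)")
    case True
    then show ?thesis using lip[OF h(1), of x n] h(1)[of n]
      by (simp add: s_def field_simps)
  next
    case False
    then have n: "norm x > R + norm e" by simp
    have "norm (h n *\<^sub>R e) \<le> norm e" using h(1)[of n] h(2)[of n] by (simp add: mult_left_le_one_le)
    then have "norm (x + h n *\<^sub>R e) > R"
      using n norm_diff_ineq[of x "h n *\<^sub>R e"] by linarith
    then have "x \<notin> S" "x + h n *\<^sub>R e \<notin> S" using R n norm_ge_zero[of e] by fastforce+
    then show ?thesis using B0 by (simp add: s_def S(2))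
  qed
  have iw: "integrable lborel (\<lambda>x::'a. indicator (cball 0 (R + norm e)) x * B)"
    using emeasure_bounded_finite[of "cball 0 (R + norm e) :: 'a set"]
    by (auto intro!: integrable_mult_left integrable_real_indicator)
  have dc: "integrable lborel G \<and> (\<lambda>n. integral\<^sup>L lborel (s n)) \<longlonglongrightarrow> integral\<^sup>L lborel G"
    using integrable_dominated_convergence[OF Gm _ iw, of s] integral_dominated_convergence[OF Gm _ iw, of s]
      sG bound by auto
  moreover have "integral\<^sup>L lborel (s n) = 0" for n
    unfolding s_def using shift iF by simp
  ultimately show "integrable lborel G" "integral\<^sup>L lborel G = 0"
    by (auto simp: LIMSEQ_const_iff)
qed

section \<open>The L2 norm: triangle inequality and continuity\<close>

text \<open>The gap between (|a| + |b|)^2 and the right side is a perfect square over t(1 - t).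
  Choosing \<open>t\<close> well after integration gives the triangle inequality for
  \<open>L2norm\<close> without passing through Cauchy-Schwarz; t = 1/2 gives closure under
  sums.\<close>

lemma cmod_add_sq_le:
  assumes "0 < t" "t < (1::real)"
  shows "(cmod (a + b))\<^sup>2 \<le> (cmod a)\<^sup>2 / t + (cmod b)\<^sup>2 / (1 - t)"
proof -
  have "(cmod (a + b))\<^sup>2 \<le> (cmod a + cmod b)\<^sup>2"
    by (simp add: norm_triangle_ineq power_mono)
  also have "\<dots> \<le> (cmod a)\<^sup>2 / t + (cmod b)\<^sup>2 / (1 - t)"
  proof -
    have "(cmod a)\<^sup>2 / t + (cmod b)\<^sup>2 / (1 - t) - (cmod a + cmod b)\<^sup>2
        = ((1 - t) * cmod a - t * cmod b)\<^sup>2 / (t * (1 - t))"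
      using assms by (simp add: field_simps power2_eq_square)
    also have "\<dots> \<ge> 0" using assms by simp
    finally show ?thesis by linarith
  qed
  finally show ?thesis .
qed

lemma L2_add:
  assumes "L2 \<Omega> f" "L2 \<Omega> g"
  shows "L2 \<Omega> (\<lambda>x. f x + g x)"
proof -
  have [measurable]: "f \<in> borel_measurable (lebesgue_on \<Omega>)" "g \<in> borel_measurable (lebesgue_on \<Omega>)"
    using assms by (auto simp: L2_def)
  have "integrable (lebesgue_on \<Omega>) (\<lambda>x. (cmod (f x))\<^sup>2 / (1/2) + (cmod (g x))\<^sup>2 / (1 - 1/2))"
    using assms by (auto simp: L2_def)
  then have "integrable (lebesgue_on \<Omega>) (\<lambda>x. (cmod (f x + g x))\<^sup>2)"
    by (rule Bochner_Integration.integrable_bound)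
       (auto intro!: AE_I2 order_trans[OF cmod_add_sq_le[of "1/2"]])
  then show ?thesis by (simp add: L2_def)
qed

lemma L2_uminus: "L2 \<Omega> f \<Longrightarrow> L2 \<Omega> (\<lambda>x. - f x)"
  by (simp add: L2_def)

lemma L2norm_nonneg: "0 \<le> L2norm \<Omega> f"
  by (simp add: L2norm_def)

lemma L2norm_sq: "(L2norm \<Omega> f)\<^sup>2 = (\<integral>x. (cmod (f x))\<^sup>2 \<partial>lebesgue_on \<Omega>)"
  by (simp add: L2norm_def)

lemma L2norm_triangle:
  assumes "L2 \<Omega> f" "L2 \<Omega> g"
  shows "L2norm \<Omega> (\<lambda>x. f x + g x) \<le> L2norm \<Omega> f + L2norm \<Omega> g"
proof -
  define a b where "a = L2norm \<Omega> f" and "b = L2norm \<Omega> g"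
  have ab: "a \<ge> 0" "b \<ge> 0" by (simp_all add: a_def b_def L2norm_nonneg)
  have "L2norm \<Omega> (\<lambda>x. f x + g x) \<le> a + b + \<epsilon>" if "\<epsilon> > 0" for \<epsilon>
  proof -
    \<comment> \<open>The optimal weight would be a/(a + b), which may be 0, 1 or undefined. Adding
      \<eta> to each norm keeps \<open>t\<close> strictly between 0 and 1, and then (a + \<eta>)^2/t
      = (a + \<eta>) s, so that the two terms add up to exactly s^2.\<close>
    define \<eta> s where "\<eta> = \<epsilon> / 2" and "s = a + b + \<epsilon>"
    define t where "t = (a + \<eta>) / s"
    have \<eta>: "\<eta> > 0" "s > 0" using that ab by (auto simp: \<eta>_def s_def)
    have t: "0 < t" "t < 1" "1 - t = (b + \<eta>) / s"
      using ab \<eta> by (auto simp: t_def field_simps) (auto simp: s_def \<eta>_def)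
    have "(L2norm \<Omega> (\<lambda>x. f x + g x))\<^sup>2 \<le> (\<integral>x. (cmod (f x))\<^sup>2 / t + (cmod (g x))\<^sup>2 / (1 - t) \<partial>lebesgue_on \<Omega>)"
      unfolding L2norm_sq using assms L2_add[OF assms] t
      by (intro integral_mono cmod_add_sq_le) (auto simp: L2_def)
    also have "\<dots> = a\<^sup>2 / t + b\<^sup>2 / (1 - t)"
      using assms t(1,2) by (simp add: L2_def a_def b_def L2norm_sq)
    also have "\<dots> \<le> (a + \<eta>)\<^sup>2 / t + (b + \<eta>)\<^sup>2 / (1 - t)"
      using ab \<eta> t by (intro add_mono divide_right_mono power_mono) auto
    also have "\<dots> = (a + \<eta>) * s + (b + \<eta>) * s"
      unfolding t(3) using ab \<eta> by (simp add: t_def power2_eq_square)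
    also have "\<dots> = s\<^sup>2" by (simp add: s_def \<eta>_def power2_eq_square algebra_simps)
    finally show ?thesis unfolding s_def[symmetric] by (rule power2_le_imp_le) (use \<eta> in simp)
  qed
  then show ?thesis unfolding a_def b_def by (rule field_le_epsilon)
qed

text \<open>By the reverse triangle inequality. This is what carries the estimate from test
  functions to their closure.\<close>

lemma tendsto_L2norm:
  assumes "L2 \<Omega> f" "\<And>n. L2 \<Omega> (\<psi> n)" "(\<lambda>n. L2norm \<Omega> (\<lambda>x. \<psi> n x - f x)) \<longlonglongrightarrow> 0"
  shows "(\<lambda>n. L2norm \<Omega> (\<psi> n)) \<longlonglongrightarrow> L2norm \<Omega> f"
proof -
  have "norm (L2norm \<Omega> (\<psi> n) - L2norm \<Omega> f) \<le> L2norm \<Omega> (\<lambda>x. \<psi> n x - f x)" for n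
  proof -
    have d: "L2 \<Omega> (\<lambda>x. \<psi> n x - f x)" "L2 \<Omega> (\<lambda>x. f x - \<psi> n x)"
      using L2_add[OF assms(2) L2_uminus[OF assms(1)]] L2_add[OF assms(1) L2_uminus[OF assms(2)]] by auto
    have "L2norm \<Omega> (\<lambda>x. f x - \<psi> n x) = L2norm \<Omega> (\<lambda>x. \<psi> n x - f x)"
      by (simp add: L2norm_def norm_minus_commute)
    then show ?thesis
      using L2norm_triangle[OF assms(1) d(1)] L2norm_triangle[OF assms(2) d(2), of n] by simp
  qed
  then have "(\<lambda>n. L2norm \<Omega> (\<psi> n) - L2norm \<Omega> f) \<longlonglongrightarrow> 0"
    using assms(3) by (intro Lim_null_comparison[OF _ assms(3)]) auto
  then show ?thesis by (simp add: LIM_zero_iff)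
qed

section \<open>Test functions: square integrability, supports and continuity\<close>

lemma L2_continuous_compact_support:
  assumes "open \<Omega>" "bounded \<Omega>" "continuous_on UNIV f" "compact S" "\<And>x. x \<notin> S \<Longrightarrow> f x = 0"
  shows "L2 \<Omega> f"
proof -
  have m: "f \<in> borel_measurable (lebesgue_on \<Omega>)"
    using assms by (intro continuous_imp_measurable_on_sets_lebesgue)
      (auto intro: continuous_on_subset)
  have "bounded (f ` S)"
    using assms by (intro compact_imp_bounded compact_continuous_image) (auto intro: continuous_on_subset)
  then obtain B where "\<And>x. x \<in> S \<Longrightarrow> cmod (f x) \<le> B" unfolding bounded_iff by blast
  \<comment> \<open>The maximum with 0 covers points off \<open>S\<close>, and an empty
    \<open>S\<close>, where \<open>B\<close> could be negative.\<close>
  then have B: "cmod (f x) \<le> max B 0" for x using assms(5)[of x] by (cases "x \<in> S") fastforce+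
  have "integrable (lebesgue_on \<Omega>) (\<lambda>x. (max B 0)\<^sup>2)"
    using assms by (intro finite_measure.integrable_const finite_measure_lebesgue_on)
      (simp add: bounded_set_imp_lmeasurable)
  then have "integrable (lebesgue_on \<Omega>) (\<lambda>x. (cmod (f x))\<^sup>2)"
    by (rule Bochner_Integration.integrable_bound) (use m B in \<open>auto intro!: AE_I2 power_mono\<close>)
  then show ?thesis using m by (simp add: L2_def)
qed

lemma test_fun_zero_outside:
  assumes "x \<notin> tsupport f"
  shows "f x = 0" "grad f x = 0"
proof -
  have z: "f y = 0" if "y \<notin> tsupport f" for y
    using that closure_subset[of "{x. f x \<noteq> 0}"] by (auto simp: tsupport_def)
  then show "f x = 0" using assms .
  have "(f has_derivative (\<lambda>_. 0)) (at x)"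
  proof (rule has_derivative_transform_within_open)
    show "((\<lambda>_. 0) has_derivative (\<lambda>_. 0)) (at x)" by simp
    show "open (- tsupport f)" by (simp add: tsupport_def open_closed)
    show "x \<in> - tsupport f" using assms by simp
    show "0 = f y" if "y \<in> - tsupport f" for y using that z by simp
  qed
  then show "grad f x = 0"
    by (simp add: grad_def vec_eq_iff frechet_derivative_at[symmetric])
qed

lemma smooth_fun_continuous:
  assumes "smooth_fun f"
  shows "continuous_on UNIV f" "continuous_on UNIV (\<lambda>x. grad f x $ k)"
    and "f differentiable (at x)"
proof -
  have 0: "dpart [] f differentiable_on UNIV" and 1: "dpart [k] f differentiable_on UNIV"
    using assms unfolding smooth_fun_def by blast+
  show "continuous_on UNIV f" "continuous_on UNIV (\<lambda>x. grad f x $ k)"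
    using differentiable_imp_continuous_on[OF 0] differentiable_imp_continuous_on[OF 1]
    by (auto simp: grad_def)
  show "f differentiable (at x)" using 0 by (simp add: differentiable_on_def)
qed

lemma test_fun_L2:
  assumes "open \<Omega>" "bounded \<Omega>" "test_fun \<Omega> \<psi>"
  shows "L2 \<Omega> \<psi>" "L2 \<Omega> (\<lambda>x. grad \<psi> x $ k)"
  using assms smooth_fun_continuous[of \<psi>] test_fun_zero_outside
  by (auto intro!: L2_continuous_compact_support[of _ _ "tsupport \<psi>"] simp: test_fun_def)

section \<open>The sharp Poincare inequality in one coordinate direction\<close>

lemma test_fun_poincare:
  fixes k :: 3
  assumes \<Omega>: "open \<Omega>" "bounded \<Omega>" and \<psi>: "test_fun \<Omega> \<psi>"
    and l: "0 < l" "\<And>x. x \<in> \<Omega> \<Longrightarrow> 0 < x $ k \<and> x $ k < l"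
  shows "pi / l * L2norm \<Omega> \<psi> \<le> L2norm \<Omega> (\<lambda>x. grad \<psi> x $ k)"
proof -
  define p where "p = pi / l"
  have p: "p > 0" using l by (simp add: p_def)
  have sm: "smooth_fun \<psi>" and cs: "compact (tsupport \<psi>)" and ss: "tsupport \<psi> \<subseteq> \<Omega>"
    using \<psi> by (auto simp: test_fun_def)
  note cont = smooth_fun_continuous(1,2)[OF sm] and zero = test_fun_zero_outside[of _ \<psi>]
  define e :: "real^3" where "e = axis k 1"
  define d where "d x = grad \<psi> x $ k" for x
  \<comment> \<open>This is the logarithmic derivative of sin(p t), the first Dirichlet
    eigenfunction on (0, l), which is why the constant p = pi/l comes out. It is singular at both
    endpoints, but the support of \<psi> is a compact subset of \<Omega> and so stays away from
    them.\<close>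
  define c where "c t = p * cot (p * t)" for t
  define F where "F x = c (x $ k) * (\<psi> x \<bullet> \<psi> x)" for x
  \<comment> \<open>This will be the derivative of \<open>F\<close> in direction \<open>e\<close>,
    written so that |d|^2 - G is p^2 |\<psi>|^2 plus a square. Expanding the square cancels |d|^2
    and leaves -(p^2 + c^2) |\<psi>|^2 + 2 c (\<psi> \<bullet> d), the product rule for
    \<open>F\<close>.\<close>
  define G where "G x = (cmod (d x))\<^sup>2 - p\<^sup>2 * (cmod (\<psi> x))\<^sup>2 - (cmod (d x - c (x $ k) *\<^sub>R \<psi> x))\<^sup>2" for x
  have sin: "sin (p * x $ k) > 0" if "x \<in> \<Omega>" for x
    using l(2)[OF that] l(1) by (intro sin_gt_zero) (auto simp: p_def field_simps)
  have cc: "continuous_on \<Omega> (\<lambda>x. c (x $ k))"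
    unfolding c_def cot_def using sin by (intro continuous_intros) (auto simp: less_imp_neq[THEN not_sym])
  \<comment> \<open>\<open>F\<close> is glued from two open sets covering the space: on \<Omega> the
    cotangent is continuous, and off the support \<open>F\<close> is 0 whatever value
    \<open>c\<close> takes there.\<close>
  have contF: "continuous_on UNIV F"
  proof -
    have "continuous_on \<Omega> F"
      unfolding F_def by (intro continuous_intros cc continuous_on_subset[OF cont(1)]) auto
    moreover have "continuous_on (- tsupport \<psi>) F"
      by (rule continuous_on_cong[THEN iffD1, OF refl _ continuous_on_const[of _ 0]])
         (simp add: F_def zero)
    moreover have "\<Omega> \<union> - tsupport \<psi> = UNIV" using ss by auto
    ultimately show ?thesis
      using continuous_on_open_Un[of \<Omega> "- tsupport \<psi>" F] \<Omega>(1)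
      by (simp add: tsupport_def open_closed)
  qed
  have D: "((\<lambda>t. F (x + t *\<^sub>R e)) has_real_derivative G x) (at 0)" for x
  proof (cases "x \<in> \<Omega>")
    case True
    have 1: "((\<lambda>t. \<psi> (x + t *\<^sub>R e)) has_vector_derivative d x) (at 0)"
    proof -
      have \<psi>': "(\<psi> has_derivative frechet_derivative \<psi> (at x)) (at (x + 0 *\<^sub>R e))"
        using smooth_fun_continuous(3)[OF sm] by (simp add: frechet_derivative_works[symmetric])
      have "((\<lambda>t. x + t *\<^sub>R e) has_derivative (\<lambda>t. t *\<^sub>R e)) (at 0)"
        by (auto intro!: derivative_eq_intros)
      from has_derivative_compose[OF this \<psi>'] have
        "((\<lambda>t. \<psi> (x + t *\<^sub>R e)) has_derivative (\<lambda>t. frechet_derivative \<psi> (at x) (t *\<^sub>R e))) (at 0)" .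
      moreover have "frechet_derivative \<psi> (at x) (t *\<^sub>R e) = t *\<^sub>R d x" for t
        using linear_frechet_derivative[OF smooth_fun_continuous(3)[OF sm]]
        by (simp add: linear_scale d_def grad_def e_def)
      ultimately show ?thesis by (simp add: has_vector_derivative_def)
    qed
    then have 2: "((\<lambda>t. \<psi> (x + t *\<^sub>R e) \<bullet> \<psi> (x + t *\<^sub>R e)) has_real_derivative 2 * (\<psi> x \<bullet> d x)) (at 0)"
      unfolding has_vector_derivative_def has_field_derivative_def
      by (auto intro!: derivative_eq_intros simp: inner_commute algebra_simps)
    \<comment> \<open>The Riccati equation for \<open>c\<close>, from 1/sin^2 = 1 + cot^2.\<close>
    have 3: "((\<lambda>t. c (x $ k + t)) has_real_derivative - (p\<^sup>2 + (c (x $ k))\<^sup>2)) (at 0)"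
    proof -
      have s: "sin (p * (x $ k + 0)) \<noteq> 0" using sin[OF True] by simp
      have "((\<lambda>t. c (x $ k + t)) has_real_derivative p * (- inverse ((sin (p * (x $ k + 0)))\<^sup>2) * p)) (at 0)"
        unfolding c_def using s
        by (auto intro!: derivative_eq_intros DERIV_chain2[OF DERIV_cot])
      moreover have "inverse ((sin (p * x $ k))\<^sup>2) = 1 + (cot (p * x $ k))\<^sup>2"
        using s by (simp add: cot_def field_simps power2_eq_square[symmetric])
      ultimately show ?thesis
        by (simp add: c_def power2_eq_square algebra_simps)
    qed
    have "((\<lambda>t. c (x $ k + t) * (\<psi> (x + t *\<^sub>R e) \<bullet> \<psi> (x + t *\<^sub>R e))) has_real_derivative
        - (p\<^sup>2 + (c (x $ k))\<^sup>2) * (\<psi> x \<bullet> \<psi> x) + 2 * (\<psi> x \<bullet> d x) * c (x $ k)) (at 0)"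
      using DERIV_mult[OF 3 2] by simp
    moreover have "- (p\<^sup>2 + (c (x $ k))\<^sup>2) * (\<psi> x \<bullet> \<psi> x) + 2 * (\<psi> x \<bullet> d x) * c (x $ k) = G x"
      unfolding G_def power2_norm_eq_inner
      by (simp add: algebra_simps inner_commute power2_eq_square)
    ultimately show ?thesis by (simp add: F_def e_def)
  next
    case False
    then have x: "x \<in> - tsupport \<psi>" using ss by auto
    \<comment> \<open>For small \<open>t\<close> the point x + t e still misses the support, so
      \<open>F\<close> vanishes along this piece of the line even if \<open>c\<close> is singular at
      \<open>x\<close>.\<close>
    have "open ((\<lambda>t. x + t *\<^sub>R e) -` (- tsupport \<psi>))"
      by (intro open_vimage) (auto simp: tsupport_def open_closed intro!: continuous_intros)
    then have "((\<lambda>t. F (x + t *\<^sub>R e)) has_real_derivative 0) (at 0)"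
      by (rule has_field_derivative_transform_within_open[OF DERIV_const[of 0]])
         (use x zero in \<open>auto simp: F_def\<close>)
    then show ?thesis using x zero by (simp add: G_def d_def)
  qed
  \<comment> \<open>\<open>c\<close> is unbounded on the slab, so the bound comes from compactness
    of the support; elsewhere \<open>G\<close> is 0.\<close>
  obtain B where B: "\<bar>G x\<bar> \<le> B" for x
  proof -
    have "continuous_on (tsupport \<psi>) G"
      unfolding G_def d_def
      by (intro continuous_intros continuous_on_subset[OF cc ss] continuous_on_subset[OF cont(1)]
          continuous_on_subset[OF cont(2)]) auto
    then have "bounded (G ` tsupport \<psi>)"
      by (intro compact_imp_bounded compact_continuous_image cs)
    then obtain B where B: "\<And>x. x \<in> tsupport \<psi> \<Longrightarrow> \<bar>G x\<bar> \<le> B" unfolding bounded_iff by auto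
    have "\<bar>G x\<bar> \<le> max B 0" for x
      using B[of x] zero[of x] by (cases "x \<in> tsupport \<psi>") (auto simp: G_def d_def)
    then show ?thesis using that by blast
  qed
  have "integrable lborel G \<and> integral\<^sup>L lborel G = 0"
    using integral_directional_derivative_eq_0[OF contF cs _ D B] zero by (simp add: F_def)
  then have "integrable lebesgue G" "integral\<^sup>L lebesgue G = 0"
    by (auto simp: integrable_completion integral_completion)
  \<comment> \<open>Since \<open>G\<close> vanishes outside \<Omega>, its integral over \<Omega> is
    the one over the whole space, namely 0.\<close>
  moreover have "(\<lambda>x. indicator \<Omega> x *\<^sub>R G x) = G"
    using ss zero by (fastforce simp: fun_eq_iff indicator_def G_def d_def)
  ultimately have iG: "integrable (lebesgue_on \<Omega>) G" "integral\<^sup>L (lebesgue_on \<Omega>) G = 0"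
    using \<Omega>(1) by (simp_all add: integrable_restrict_space integral_restrict_space)
  have L: "L2 \<Omega> \<psi>" "L2 \<Omega> d"
    using test_fun_L2[OF \<Omega> \<psi>] by (simp_all add: d_def[abs_def])
  have "p\<^sup>2 * (L2norm \<Omega> \<psi>)\<^sup>2 = (\<integral>x. p\<^sup>2 * (cmod (\<psi> x))\<^sup>2 \<partial>lebesgue_on \<Omega>)"
    by (simp add: L2norm_sq)
  also have "\<dots> \<le> (\<integral>x. (cmod (d x))\<^sup>2 - G x \<partial>lebesgue_on \<Omega>)"
  proof (rule integral_mono)
    show "p\<^sup>2 * (cmod (\<psi> x))\<^sup>2 \<le> (cmod (d x))\<^sup>2 - G x" for x by (simp add: G_def)
  qed (use L iG in \<open>auto simp: L2_def\<close>)
  also have "\<dots> = (L2norm \<Omega> d)\<^sup>2"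
    using L iG by (simp add: L2norm_sq L2_def)
  finally have "(p * L2norm \<Omega> \<psi>)\<^sup>2 \<le> (L2norm \<Omega> d)\<^sup>2" by (simp add: power_mult_distrib)
  then show ?thesis
    using L2norm_nonneg by (auto dest: power2_le_imp_le simp: p_def d_def[abs_def])
qed

lemma H01_poincare:
  fixes k :: 3
  assumes \<Omega>: "open \<Omega>" "bounded \<Omega>" and "H01 \<Omega> \<phi> g"
    and "0 < l" "\<And>x. x \<in> \<Omega> \<Longrightarrow> 0 < x $ k \<and> x $ k < l"
  shows "pi / l * L2norm \<Omega> \<phi> \<le> L2norm \<Omega> (\<lambda>x. g x $ k)"
proof -
  obtain \<psi> where \<psi>: "\<And>n. test_fun \<Omega> (\<psi> n)"
    "(\<lambda>n. L2norm \<Omega> (\<lambda>x. \<psi> n x - \<phi> x)) \<longlonglongrightarrow> 0"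
    "(\<lambda>n. L2norm \<Omega> (\<lambda>x. grad (\<psi> n) x $ k - g x $ k)) \<longlonglongrightarrow> 0"
    and L: "L2 \<Omega> \<phi>" "L2 \<Omega> (\<lambda>x. g x $ k)"
    using assms(3) unfolding H01_def by blast
  note T = test_fun_L2[OF \<Omega> \<psi>(1)]
  show ?thesis
  proof (rule LIMSEQ_le)
    show "(\<lambda>n. pi / l * L2norm \<Omega> (\<psi> n)) \<longlonglongrightarrow> pi / l * L2norm \<Omega> \<phi>"
      by (intro tendsto_mult_left tendsto_L2norm L T \<psi>)
    show "(\<lambda>n. L2norm \<Omega> (\<lambda>x. grad (\<psi> n) x $ k)) \<longlonglongrightarrow> L2norm \<Omega> (\<lambda>x. g x $ k)"
      by (rule tendsto_L2norm[OF L(2) T(2) \<psi>(3)])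
    show "\<exists>N. \<forall>n\<ge>N. pi / l * L2norm \<Omega> (\<psi> n) \<le> L2norm \<Omega> (\<lambda>x. grad (\<psi> n) x $ k)"
      using test_fun_poincare[OF \<Omega> \<psi>(1) assms(4,5)] by blast
  qed
qed

section \<open>Lower bounds for the Hermitian form and the energy\<close>

text \<open>The two conjugate off-diagonal terms have equal real part, at least -|a||w||z|. Then
  2|w||z| is at most |z|^2 + |w|^2, and |a| is at most |Re a| + |Im a|.\<close>

lemma Re_hermitian_pair_ge:
  fixes a b z w :: complex
  assumes "b = cnj a"
  shows "0 \<le> Re (a * w * cnj z) + Re (b * z * cnj w) + (\<bar>Re a\<bar> + \<bar>Im a\<bar>) * ((cmod z)\<^sup>2 + (cmod w)\<^sup>2)"
proof -
  have "b * z * cnj w = cnj (a * w * cnj z)" using assms by simp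
  then have "Re (b * z * cnj w) = Re (a * w * cnj z)" by (simp only: cnj.sel(1))
  then have "Re (a * w * cnj z) + Re (b * z * cnj w) = 2 * Re (a * w * cnj z)" by (simp only: mult_2)
  also have "\<dots> \<ge> - (2 * (cmod a * (cmod w * cmod z)))"
    using abs_Re_le_cmod[of "a * w * cnj z"] by (simp add: norm_mult)
  moreover have "2 * (cmod a * (cmod w * cmod z)) \<le> cmod a * ((cmod z)\<^sup>2 + (cmod w)\<^sup>2)"
    using mult_left_mono[OF sum_squares_bound[of "cmod w" "cmod z"], of "cmod a"]
    by (simp add: algebra_simps)
  moreover have "\<dots> \<le> (\<bar>Re a\<bar> + \<bar>Im a\<bar>) * ((cmod z)\<^sup>2 + (cmod w)\<^sup>2)"
    by (intro mult_right_mono cmod_le) auto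
  ultimately show ?thesis by linarith
qed

text \<open>Each of the three off-diagonal pairs costs its weight |Re| + |Im| in both of the rows it
  couples. Collecting these costs row by row yields exactly what the reduced coefficients subtract
  from the diagonal.\<close>

lemma hermitian_form_ge_atilde:
  assumes "\<forall>i j. \<alpha> x $ i $ j = cnj (\<alpha> x $ j $ i)"
  shows "atilde1 \<alpha> x * (cmod (v $ 1))\<^sup>2 + atilde2 \<alpha> x * (cmod (v $ 2))\<^sup>2 + atilde3 \<alpha> x * (cmod (v $ 3))\<^sup>2
    \<le> Re (\<Sum>i\<in>UNIV. \<Sum>j\<in>UNIV. \<alpha> x $ i $ j * v $ j * cnj (v $ i))"
proof -
  have diag: "Re (\<alpha> x $ i $ i * v $ i * cnj (v $ i)) = Re (\<alpha> x $ i $ i) * (cmod (v $ i))\<^sup>2" for i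
    by (simp add: mult.assoc complex_norm_square[symmetric] flip: of_real_power)
  have s: "\<alpha> x $ j $ i = cnj (\<alpha> x $ i $ j)" for i j using assms by blast
  show ?thesis
    using Re_hermitian_pair_ge[OF s[of 2 1], where w = "v $ 2" and z = "v $ 1"]
      Re_hermitian_pair_ge[OF s[of 3 1], where w = "v $ 3" and z = "v $ 1"]
      Re_hermitian_pair_ge[OF s[of 3 2], where w = "v $ 3" and z = "v $ 2"] diag[of 1] diag[of 2] diag[of 3]
    unfolding sum_3 atilde1_def atilde2_def atilde3_def plus_complex.sel
    by (simp only: algebra_simps)
qed

text \<open>A Bochner integral is 0 by convention when the integrand is not integrable, so comparing
  \<open>energy\<close> with other integrals requires this. The product is dominated by a multiple
  of |f|^2 + |h|^2.\<close>

lemma integrable_bounded_mult_L2: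
  fixes m :: "real^3 \<Rightarrow> complex"
  assumes "m \<in> borel_measurable (lebesgue_on \<Omega>)" "AE x in lebesgue_on \<Omega>. cmod (m x) \<le> M"
    and f: "L2 \<Omega> f" and h: "L2 \<Omega> h"
  shows "integrable (lebesgue_on \<Omega>) (\<lambda>x. m x * f x * cnj (h x))"
proof -
  have [measurable]: "m \<in> borel_measurable (lebesgue_on \<Omega>)" "f \<in> borel_measurable (lebesgue_on \<Omega>)"
    "h \<in> borel_measurable (lebesgue_on \<Omega>)" using assms by (auto simp: L2_def)
  have [measurable]: "(\<lambda>x. cnj (h x)) \<in> borel_measurable (lebesgue_on \<Omega>)"
    by (rule borel_measurable_continuous_on[of cnj]) (auto intro: continuous_intros)
  have "integrable (lebesgue_on \<Omega>) (\<lambda>x. M * ((cmod (f x))\<^sup>2 + (cmod (h x))\<^sup>2))"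
    using f h by (simp add: L2_def)
  then show ?thesis
  proof (rule Bochner_Integration.integrable_bound)
    show "AE x in lebesgue_on \<Omega>. norm (m x * f x * cnj (h x)) \<le> norm (M * ((cmod (f x))\<^sup>2 + (cmod (h x))\<^sup>2))"
      using assms(2)
    proof eventually_elim
      case (elim x)
      have "2 * (cmod (f x) * cmod (h x)) \<le> (cmod (f x))\<^sup>2 + (cmod (h x))\<^sup>2"
        using sum_squares_bound[of "cmod (f x)" "cmod (h x)"] by simp
      moreover have "0 \<le> cmod (f x) * cmod (h x)" by simp
      ultimately have "cmod (f x) * cmod (h x) \<le> (cmod (f x))\<^sup>2 + (cmod (h x))\<^sup>2" by linarith
      then have "cmod (m x) * (cmod (f x) * cmod (h x)) \<le> \<bar>M\<bar> * ((cmod (f x))\<^sup>2 + (cmod (h x))\<^sup>2)"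
        using elim by (intro mult_mono) auto
      then show ?case by (simp add: norm_mult abs_mult)
    qed
  qed measurable
qed

lemma L2inner_of_real_mult:
  assumes m: "m \<in> borel_measurable (lebesgue_on \<Omega>)" "AE x in lebesgue_on \<Omega>. \<bar>m x\<bar> \<le> M"
    and f: "L2 \<Omega> f"
  shows "integrable (lebesgue_on \<Omega>) (\<lambda>x. m x * (cmod (f x))\<^sup>2)"
    and "Re (L2inner \<Omega> (\<lambda>x. of_real (m x) * f x) f) = (\<integral>x. m x * (cmod (f x))\<^sup>2 \<partial>lebesgue_on \<Omega>)"
proof -
  have eq: "of_real (m x) * f x * cnj (f x) = of_real (m x * (cmod (f x))\<^sup>2)" for x
    by (simp only: mult.assoc complex_norm_square[symmetric] of_real_mult of_real_power)
  have "integrable (lebesgue_on \<Omega>) (\<lambda>x. of_real (m x) * f x * cnj (f x))"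
    using m by (intro integrable_bounded_mult_L2[OF _ _ f f]) auto
  then show "integrable (lebesgue_on \<Omega>) (\<lambda>x. m x * (cmod (f x))\<^sup>2)"
    unfolding eq complex_of_real_integrable_eq .
  show "Re (L2inner \<Omega> (\<lambda>x. of_real (m x) * f x) f) = (\<integral>x. m x * (cmod (f x))\<^sup>2 \<partial>lebesgue_on \<Omega>)"
    unfolding L2inner_def eq integral_complex_of_real by simp
qed

lemma energy_ge:
  assumes meas: "\<forall>i j. (\<lambda>x. \<alpha> x $ i $ j) \<in> borel_measurable (lebesgue_on \<Omega>)"
    and bdd: "\<exists>M. AE x in lebesgue_on \<Omega>. \<forall>i j. cmod (\<alpha> x $ i $ j) \<le> M"
    and herm: "AE x in lebesgue_on \<Omega>. \<forall>i j. \<alpha> x $ i $ j = cnj (\<alpha> x $ j $ i)"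
    and g: "\<forall>k. L2 \<Omega> (\<lambda>x. g x $ k)"
  shows "Re (L2inner \<Omega> (\<lambda>x. of_real (atilde1 \<alpha> x) * g x $ 1) (\<lambda>x. g x $ 1))
     + Re (L2inner \<Omega> (\<lambda>x. of_real (atilde2 \<alpha> x) * g x $ 2) (\<lambda>x. g x $ 2))
     + Re (L2inner \<Omega> (\<lambda>x. of_real (atilde3 \<alpha> x) * g x $ 3) (\<lambda>x. g x $ 3)) \<le> Re (energy \<Omega> \<alpha> g)"
proof -
  have [measurable]: "(\<lambda>x. \<alpha> x $ i $ j) \<in> borel_measurable (lebesgue_on \<Omega>)" for i j using meas by blast
  obtain M where M: "AE x in lebesgue_on \<Omega>. \<forall>i j. cmod (\<alpha> x $ i $ j) \<le> M" using bdd by blast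
  have m: "(\<lambda>x. atilde1 \<alpha> x) \<in> borel_measurable (lebesgue_on \<Omega>)"
    "(\<lambda>x. atilde2 \<alpha> x) \<in> borel_measurable (lebesgue_on \<Omega>)"
    "(\<lambda>x. atilde3 \<alpha> x) \<in> borel_measurable (lebesgue_on \<Omega>)"
    unfolding atilde1_def atilde2_def atilde3_def by measurable
  \<comment> \<open>The factor 5 counts the diagonal term and the four subtracted absolute values,
    each at most \<open>M\<close>.\<close>
  have b: "AE x in lebesgue_on \<Omega>. \<bar>atilde1 \<alpha> x\<bar> \<le> 5 * M \<and> \<bar>atilde2 \<alpha> x\<bar> \<le> 5 * M \<and> \<bar>atilde3 \<alpha> x\<bar> \<le> 5 * M"
    using M
  proof eventually_elim
    case (elim x)
    have B: "\<bar>Re (\<alpha> x $ i $ j)\<bar> \<le> M" "\<bar>Im (\<alpha> x $ i $ j)\<bar> \<le> M" for i j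
      using elim abs_Re_le_cmod abs_Im_le_cmod order_trans by blast+
    have "\<bar>r - (s + t + u + v)\<bar> \<le> 5 * M"
      if "\<bar>r\<bar> \<le> M" "0 \<le> s" "s \<le> M" "0 \<le> t" "t \<le> M" "0 \<le> u" "u \<le> M" "0 \<le> v" "v \<le> M"
      for r s t u v :: real
      using that by linarith
    then show ?case unfolding atilde1_def atilde2_def atilde3_def by (intro conjI) (simp_all only: B abs_ge_zero)
  qed
  have b1: "AE x in lebesgue_on \<Omega>. \<bar>atilde1 \<alpha> x\<bar> \<le> 5 * M"
    and b2: "AE x in lebesgue_on \<Omega>. \<bar>atilde2 \<alpha> x\<bar> \<le> 5 * M"
    and b3: "AE x in lebesgue_on \<Omega>. \<bar>atilde3 \<alpha> x\<bar> \<le> 5 * M"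
    using b by (auto elim: eventually_mono)
  note I = L2inner_of_real_mult[OF m(1) b1 g[rule_format, of 1]]
    L2inner_of_real_mult[OF m(2) b2 g[rule_format, of 2]]
    L2inner_of_real_mult[OF m(3) b3 g[rule_format, of 3]]
  have E: "integrable (lebesgue_on \<Omega>) (\<lambda>x. \<Sum>i\<in>UNIV. \<Sum>j\<in>UNIV. \<alpha> x $ i $ j * g x $ j * cnj (g x $ i))"
  proof (intro Bochner_Integration.integrable_sum)
    fix i j :: 3
    have "AE x in lebesgue_on \<Omega>. cmod (\<alpha> x $ i $ j) \<le> M" using M by (auto elim: eventually_mono)
    then show "integrable (lebesgue_on \<Omega>) (\<lambda>x. \<alpha> x $ i $ j * g x $ j * cnj (g x $ i))"
      using g by (intro integrable_bounded_mult_L2) auto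
  qed
  have "(\<integral>x. atilde1 \<alpha> x * (cmod (g x $ 1))\<^sup>2 + atilde2 \<alpha> x * (cmod (g x $ 2))\<^sup>2
      + atilde3 \<alpha> x * (cmod (g x $ 3))\<^sup>2 \<partial>lebesgue_on \<Omega>)
    \<le> (\<integral>x. Re (\<Sum>i\<in>UNIV. \<Sum>j\<in>UNIV. \<alpha> x $ i $ j * g x $ j * cnj (g x $ i)) \<partial>lebesgue_on \<Omega>)"
  proof (rule integral_mono_AE)
    show "AE x in lebesgue_on \<Omega>. atilde1 \<alpha> x * (cmod (g x $ 1))\<^sup>2 + atilde2 \<alpha> x * (cmod (g x $ 2))\<^sup>2
      + atilde3 \<alpha> x * (cmod (g x $ 3))\<^sup>2
      \<le> Re (\<Sum>i\<in>UNIV. \<Sum>j\<in>UNIV. \<alpha> x $ i $ j * g x $ j * cnj (g x $ i))"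
      using herm by eventually_elim (rule hermitian_form_ge_atilde)
  qed (use I E in \<open>auto simp del: Re_sum\<close>)
  then show ?thesis using I E by (simp add: energy_def del: Re_sum)
qed

section \<open>Combining the three directions\<close>

theorem theorem2p4:
  fixes l1 l2 l3 a1 a2 a3 :: real
    and \<Omega> :: "(real^3) set"
    and \<alpha> :: "real^3 \<Rightarrow> complex^3^3"
  assumes "0 < l1" "0 < l2" "0 < l3"
    and "open \<Omega>" "connected \<Omega>" "\<Omega> \<noteq> {}" "bounded \<Omega>"
    and "\<Omega> \<subseteq> {x. 0 < x$1 \<and> x$1 < l1 \<and> 0 < x$2 \<and> x$2 < l2 \<and> 0 < x$3 \<and> x$3 < l3}"
    and "\<forall>i j. (\<lambda>x. \<alpha> x $ i $ j) \<in> borel_measurable (lebesgue_on \<Omega>)"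
    and "\<exists>M. AE x in lebesgue_on \<Omega>. \<forall>i j. cmod (\<alpha> x $ i $ j) \<le> M"
    and "AE x in lebesgue_on \<Omega>. \<forall>i j. \<alpha> x $ i $ j = cnj (\<alpha> x $ j $ i)"
    and "0 < a1" "0 < a2" "0 < a3"
    and "\<forall>\<phi>. L2 \<Omega> \<phi> \<longrightarrow> a1 * (L2norm \<Omega> \<phi>)^2 \<le> Re (L2inner \<Omega> (\<lambda>x. of_real (atilde1 \<alpha> x) * \<phi> x) \<phi>)"
    and "\<forall>\<phi>. L2 \<Omega> \<phi> \<longrightarrow> a2 * (L2norm \<Omega> \<phi>)^2 \<le> Re (L2inner \<Omega> (\<lambda>x. of_real (atilde2 \<alpha> x) * \<phi> x) \<phi>)"
    and "\<forall>\<phi>. L2 \<Omega> \<phi> \<longrightarrow> a3 * (L2norm \<Omega> \<phi>)^2 \<le> Re (L2inner \<Omega> (\<lambda>x. of_real (atilde3 \<alpha> x) * \<phi> x) \<phi>)"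
  shows "cf \<Omega> \<alpha> \<le> 1 / (pi * sqrt (a1 / l1^2 + a2 / l2^2 + a3 / l3^2))"
proof -
  define S where "S = a1 / l1^2 + a2 / l2^2 + a3 / l3^2"
  have S: "S > 0" unfolding S_def using assms by (intro add_pos_pos) auto
  have main: "L2norm \<Omega> \<phi> \<le> 1 / (pi * sqrt S) * sqrt (Re (energy \<Omega> \<alpha> g))" if H: "H01 \<Omega> \<phi> g" for \<phi> g
  proof -
    have L: "\<forall>k. L2 \<Omega> (\<lambda>x. g x $ k)" using H by (simp add: H01_def)
    define N where "N = L2norm \<Omega> \<phi>"
    have N: "N \<ge> 0" by (simp add: N_def L2norm_nonneg)
    have P: "a * (pi / l)\<^sup>2 * N\<^sup>2 \<le> a * (L2norm \<Omega> (\<lambda>x. g x $ k))\<^sup>2"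
      if "0 < a" "0 < l" "\<And>x. x \<in> \<Omega> \<Longrightarrow> 0 < x $ k \<and> x $ k < l" for a l and k :: 3
    proof -
      have "(pi / l * N)\<^sup>2 \<le> (L2norm \<Omega> (\<lambda>x. g x $ k))\<^sup>2"
        using H01_poincare[OF assms(4,7) H that(2,3)] that(2) N by (intro power_mono) (auto simp: N_def)
      then show ?thesis using that(1) by (simp only: power_mult_distrib[symmetric] mult.assoc) simp
    qed
    \<comment> \<open>The square is split over the directions, so that each summand is matched by
      the Poincare inequality along its own axis.\<close>
    have "(pi * sqrt S * N)\<^sup>2 = a1 * (pi / l1)\<^sup>2 * N\<^sup>2 + a2 * (pi / l2)\<^sup>2 * N\<^sup>2 + a3 * (pi / l3)\<^sup>2 * N\<^sup>2"
      using S by (simp add: power_mult_distrib power_divide) (simp add: S_def algebra_simps)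
    also have "\<dots> \<le> a1 * (L2norm \<Omega> (\<lambda>x. g x $ 1))\<^sup>2 + a2 * (L2norm \<Omega> (\<lambda>x. g x $ 2))\<^sup>2
        + a3 * (L2norm \<Omega> (\<lambda>x. g x $ 3))\<^sup>2"
      using assms(1-3,8,12-14) by (intro add_mono P) auto
    \<comment> \<open>The coercivity assumptions are applied to the components of the gradient
      \<open>g\<close>, not to \<phi>.\<close>
    also have "\<dots> \<le> Re (energy \<Omega> \<alpha> g)"
      using assms(15-17)[rule_format, OF L[rule_format]] energy_ge[OF assms(9-11) L]
      by (meson add_mono order_trans)
    finally have "pi * sqrt S * N \<le> sqrt (Re (energy \<Omega> \<alpha> g))"
      by (rule real_le_rsqrt)
    then show ?thesis using S by (simp add: N_def field_simps)
  qed
  show ?thesis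
    unfolding cf_def S_def[symmetric]
  \<comment> \<open>As \<open>cf\<close> is an infimum, it suffices that the claimed value is
    admissible; the constraint 0 \<le> c supplies the lower bound that a real infimum needs.\<close>
  proof (rule cInf_lower)
    show "1 / (pi * sqrt S) \<in> {c. 0 \<le> c \<and> (\<forall>\<phi> g. H01 \<Omega> \<phi> g \<longrightarrow>
       L2norm \<Omega> \<phi> \<le> c * sqrt (Re (energy \<Omega> \<alpha> g)))}"
      using main S by simp
    show "bdd_below {c. 0 \<le> c \<and> (\<forall>\<phi> g. H01 \<Omega> \<phi> g \<longrightarrow>
       L2norm \<Omega> \<phi> \<le> c * sqrt (Re (energy \<Omega> \<alpha> g)))}"
      by (rule bdd_belowI[of _ 0]) simp
  qed
qed

end
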